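(* For every prime power $q$, there exists a $(q-1)$-IPC$(q^2+1,q^2)$.
   Context: For permutations $\sigma,\tau$ of an $n$-element set, the Hamming distance is the number of points $x$ with $\sigma(x)\neq\tau(x)$. A permutation code PC$(n,d)$ is a set of permutations of an $n$-element set in which any two distinct elements are at Hamming distance at least $d$. A permutation code is idempotent if each of its words has exactly one fixed point. An $r$-IPC$(n,n-1)$ is an idempotent PC$(n,n-1)$ on an $n$-element symbol set in which every symbol is the fixed point of exactly $r$ words. *)

theory Defs
  imports "HOL-Number_Theory.Prime_Powers" "HOL-Combinatorics.Permutations"
begin

definition hamming_dist :: "'a set \<Rightarrow> ('a \<Rightarrow> 'a) \<Rightarrow> ('a \<Rightarrow> 'a) \<Rightarrow> nat" where
  "hamming_dist X \<sigma> \<tau> = card {x \<in> X. \<sigma> x \<noteq> \<tau> x}"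

definition permutation_code :: "nat \<Rightarrow> nat \<Rightarrow> 'a set \<Rightarrow> ('a \<Rightarrow> 'a) set \<Rightarrow> bool" where
  "permutation_code n d X C \<longleftrightarrow>
     finite X \<and> card X = n \<and>
     (\<forall>\<sigma>\<in>C. \<sigma> permutes X) \<and>
     (\<forall>\<sigma>\<in>C. \<forall>\<tau>\<in>C. \<sigma> \<noteq> \<tau> \<longrightarrow> d \<le> hamming_dist X \<sigma> \<tau>)"

text \<open>Fixed points are counted inside \<open>X\<close> only: a function that \<open>permutes\<close> \<open>X\<close>
  is the identity everywhere outside \<open>X\<close>.\<close>

definition idempotent_code :: "'a set \<Rightarrow> ('a \<Rightarrow> 'a) set \<Rightarrow> bool" where
  "idempotent_code X C \<longleftrightarrow> (\<forall>\<sigma>\<in>C. \<exists>!x. x \<in> X \<and> \<sigma> x = x)"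

definition r_IPC :: "nat \<Rightarrow> nat \<Rightarrow> nat \<Rightarrow> 'a set \<Rightarrow> ('a \<Rightarrow> 'a) set \<Rightarrow> bool" where
  "r_IPC r n d X C \<longleftrightarrow>
     permutation_code n d X C \<and> idempotent_code X C \<and>
     (\<forall>x\<in>X. card {\<sigma> \<in> C. \<sigma> x = x} = r)"

end

theory Submission
  imports Defs "HOL-Algebra.Algebraic_Closure" "HOL-Number_Theory.Residues"
begin

text \<open>Let \<open>F\<close> be the field with \<open>q\<^sup>2\<close> elements, \<open>K\<close> its subfield with \<open>q\<close> elements,
  \<open>\<theta> \<in> F - K\<close> and \<open>A = K\<^sup>* \<theta>\<close>. The elements of \<open>A\<close> lie in distinct nontrivial cosets of \<open>K\<close>.
  Partition and extension is applied to the affine group of \<open>F\<close> over the point set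
  \<open>F \<union> {\<infinity>}\<close>. The \<open>q - 1\<close> words fixing \<open>\<infinity>\<close> are the translations by \<open>K\<^sup>*\<close>. For \<open>x \<in> F\<close> and
  \<open>a \<in> A\<close>, the map \<open>f(y) = a (y - x) + x\<close> fixes only \<open>x\<close>; since \<open>F = K \<oplus> a K\<close>, there is
  \<open>u \<in> a + K\<close> with \<open>f(u) \<in> a - \<theta> + K\<close>, and rerouting \<open>u \<mapsto> \<infinity> \<mapsto> f(u)\<close> extends \<open>f\<close> to the new
  point. Two words with distinct multipliers agree at most once because two such affine maps do and
  the cosets used for \<open>u\<close>, and those used for \<open>f(u)\<close>, are disjoint. Two affine maps with the
  same multiplier agree nowhere, so their extensions can only agree at \<open>u\<close> or at \<open>\<infinity>\<close>, and not at
  both.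

  The fields are the fixed sets of \<open>x \<mapsto> x\<^sup>q\<close> and \<open>x \<mapsto> x^(q\<^sup>2)\<close> in an algebraic closure of the
  prime field.\<close>

(* HOL-Algebra reserves X for the indeterminate of a polynomial ring. *)
no_notation var (\<open>X\<index>\<close>)

section \<open>Agreement counts and extension of a permutation by one point\<close>

lemma hamming_dist_geI:
  assumes "finite X" "card X = Suc n"
    and agree: "\<And>x y. \<lbrakk>x \<in> X; y \<in> X; \<sigma> x = \<tau> x; \<sigma> y = \<tau> y\<rbrakk> \<Longrightarrow> x = y"
  shows "n \<le> hamming_dist X \<sigma> \<tau>"
proof -
  let ?E = "{x \<in> X. \<sigma> x = \<tau> x}"
  have "card ?E \<le> Suc 0"
    using assms(1) agree by (subst card_le_Suc0_iff_eq) auto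
  moreover have "card X = card ?E + hamming_dist X \<sigma> \<tau>"
    unfolding hamming_dist_def using assms(1)
    by (subst card_Un_disjoint[symmetric]) (auto intro!: arg_cong[where f = card])
  ultimately show ?thesis
    using assms(2) by simp
qed

text \<open>When \<open>f\<close> fixes \<open>w\<close>, this reroutes \<open>u\<close> to
  \<open>w\<close> and \<open>w\<close> to \<open>f u\<close>. As a composition with a
  transposition, it is visibly a permutation.\<close>

definition extend_perm :: "'a \<Rightarrow> 'a \<Rightarrow> ('a \<Rightarrow> 'a) \<Rightarrow> 'a \<Rightarrow> 'a" where
  "extend_perm w u f = transpose w (f u) \<circ> f"

lemma extend_perm_permutes:
  assumes "f permutes V" "u \<in> V"
  shows "extend_perm w u f permutes insert w V"
  unfolding extend_perm_def
  using assms permutes_in_image[OF assms(1)]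
  by (intro permutes_compose permutes_swap_id permutes_subset[OF assms(1)]) auto

lemma extend_perm_simps:
  assumes "f permutes V" "u \<in> V" "w \<notin> V"
  shows "extend_perm w u f u = w" "extend_perm w u f w = f u"
    and "\<lbrakk>z \<in> V; z \<noteq> u\<rbrakk> \<Longrightarrow> extend_perm w u f z = f z"
proof -
  have f: "f w = w" "\<And>z. z \<in> V \<Longrightarrow> f z \<in> V" "inj f"
    using assms permutes_in_image[OF assms(1)] permutes_inj[OF assms(1)]
    by (auto simp: permutes_def)
  show "extend_perm w u f u = w" "extend_perm w u f w = f u"
    by (simp_all add: extend_perm_def f)
  show "extend_perm w u f z = f z" if "z \<in> V" "z \<noteq> u"
  proof -
    have "f z \<noteq> w" "f z \<noteq> f u"
      using that f assms by (metis, metis injD)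
    then show ?thesis by (simp add: extend_perm_def transpose_apply_other)
  qed
qed

section \<open>Partition and extension in abstract form\<close>

text \<open>Separates the combinatorics from the field arithmetic. Before rerouting, all words fix
  \<open>w\<close>, an agreement on top of a possible one inside \<open>V\<close>. For distinct
  indices \<open>a\<close>, the last assumption on \<open>u\<close> removes the agreement at
  \<open>w\<close>, and the one before it prevents a new one at the points sent to
  \<open>w\<close>.\<close>

lemma r_IPC_by_extension:
  fixes f :: "'i \<Rightarrow> 'a \<Rightarrow> 'a \<Rightarrow> 'a"
  assumes V: "finite V" "card V = n" "w \<notin> V"
    and A: "card A = r"
    and T: "card T = r" "\<And>t. t \<in> T \<Longrightarrow> t permutes V"
      "\<And>t y. \<lbrakk>t \<in> T; y \<in> V\<rbrakk> \<Longrightarrow> t y \<noteq> y"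
      "\<And>t t' y. \<lbrakk>t \<in> T; t' \<in> T; y \<in> V; t y = t' y\<rbrakk> \<Longrightarrow> t = t'"
    and f: "\<And>a x. \<lbrakk>a \<in> A; x \<in> V\<rbrakk> \<Longrightarrow> f a x permutes V"
      "\<And>a x y. \<lbrakk>a \<in> A; x \<in> V; y \<in> V\<rbrakk> \<Longrightarrow> f a x y = y \<longleftrightarrow> y = x"
      "\<And>a x x' y. \<lbrakk>a \<in> A; x \<in> V; x' \<in> V; y \<in> V; f a x y = f a x' y\<rbrakk> \<Longrightarrow> x = x'"
      "\<And>a a' x x' y z. \<lbrakk>a \<in> A; a' \<in> A; a \<noteq> a'; x \<in> V; x' \<in> V; y \<in> V; z \<in> V;
          f a x y = f a' x' y; f a x z = f a' x' z\<rbrakk> \<Longrightarrow> y = z"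
      "\<And>a t x y z. \<lbrakk>a \<in> A; t \<in> T; x \<in> V; y \<in> V; z \<in> V;
          f a x y = t y; f a x z = t z\<rbrakk> \<Longrightarrow> y = z"
    and u: "\<And>a x. \<lbrakk>a \<in> A; x \<in> V\<rbrakk> \<Longrightarrow> u a x \<in> V"
      "\<And>a x. \<lbrakk>a \<in> A; x \<in> V\<rbrakk> \<Longrightarrow> u a x \<noteq> x"
      "\<And>a a' x x'. \<lbrakk>a \<in> A; a' \<in> A; x \<in> V; x' \<in> V; u a x = u a' x'\<rbrakk> \<Longrightarrow> a = a'"
      "\<And>a a' x x'. \<lbrakk>a \<in> A; a' \<in> A; x \<in> V; x' \<in> V;
          f a x (u a x) = f a' x' (u a' x')\<rbrakk> \<Longrightarrow> a = a'"
  shows "r_IPC r (Suc n) n (insert w V)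
           (T \<union> (\<lambda>(a, x). extend_perm w (u a x) (f a x)) ` (A \<times> V))"
proof -
  define g where "g a x = extend_perm w (u a x) (f a x)" for a x
  define X where "X = insert w V"
  have X: "finite X" "card X = Suc n"
    using V by (auto simp: X_def)
  have g_perm: "g a x permutes X" if "a \<in> A" "x \<in> V" for a x
    unfolding g_def X_def using that f(1) u(1) by (intro extend_perm_permutes)
  have t_perm: "t permutes X" if "t \<in> T" for t
    unfolding X_def using T(2)[OF that] by (rule permutes_subset) auto
  have t_w: "t w = w" if "t \<in> T" for t
    using T(2)[OF that] V(3) by (simp add: permutes_not_in)
  have t_V: "t y \<in> V" if "t \<in> T" "y \<in> V" for t y
    using T(2)[OF that(1)] that(2) by (simp add: permutes_in_image)
  have f_V: "f a x y \<in> V" if "a \<in> A" "x \<in> V" "y \<in> V" for a x y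
    using f(1)[OF that(1,2)] that(3) by (simp add: permutes_in_image)
  have g_u: "g a x (u a x) = w" and g_w: "g a x w = f a x (u a x)"
    and g_V: "\<And>z. \<lbrakk>z \<in> V; z \<noteq> u a x\<rbrakk> \<Longrightarrow> g a x z = f a x z"
    if "a \<in> A" "x \<in> V" for a x
    unfolding g_def using extend_perm_simps[OF f(1)[OF that] u(1)[OF that] V(3)] by auto
  \<comment> \<open>Rerouting moves both \<open>w\<close> and \<open>u a x\<close>, so it creates no
    fixed point; since \<open>u a x \<noteq> x\<close>, it does not destroy the old one.\<close>
  have g_fix: "g a x z = z \<longleftrightarrow> z = x" if "a \<in> A" "x \<in> V" "z \<in> X" for a x z
    using that g_u g_w g_V f_V f(2) u(1,2) V(3) unfolding X_def by (metis insertE)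
  have t_fix: "t z = z \<longleftrightarrow> z = w" if "t \<in> T" "z \<in> X" for t z
    using that t_w T(3) unfolding X_def by auto
  have gg: "n \<le> hamming_dist X (g a x) (g a' x')"
    if a: "a \<in> A" "x \<in> V" "a' \<in> A" "x' \<in> V" and ne: "g a x \<noteq> g a' x'" for a x a' x'
  proof (rule hamming_dist_geI[OF X])
    fix y z assume yz: "y \<in> X" "z \<in> X" "g a x y = g a' x' y" "g a x z = g a' x' z"
    show "y = z"
    proof (cases "a = a'")
      case True
      have "x \<noteq> x'" using True ne by auto
      \<comment> \<open>For equal \<open>a\<close> the unextended maps agree nowhere on
        \<open>V\<close>. Hence an agreement sits at \<open>w\<close> or at a common rerouted point;
        both together would make the unextended maps agree at that point.\<close>
      have *: "v = w \<and> f a x (u a x) = f a x' (u a x') \<or> v = u a x \<and> v = u a x'"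
        if "v \<in> X" "g a x v = g a x' v" for v
        using that a True \<open>x \<noteq> x'\<close> f(3) g_u g_w g_V f_V V(3) u(1) unfolding X_def
        by (metis insertE)
      show ?thesis
        using *[of y] *[of z] yz True f(3)[of a x x' "u a x"] a \<open>x \<noteq> x'\<close> u(1) by metis
    next
      case False
      \<comment> \<open>For distinct \<open>a\<close> the images of \<open>w\<close> differ and so
        do the preimages of \<open>w\<close>, so every agreement is one of the unextended
        maps.\<close>
      have *: "v \<in> V \<and> f a x v = f a' x' v" if "v \<in> X" "g a x v = g a' x' v" for v
        using that a False u(1,3,4) g_u g_w g_V f_V V(3) unfolding X_def
        by (metis insertE)
      show ?thesis
        using *[of y] *[of z] yz f(4)[of a a' x x' y z] a False by metis
    qed
  qed
  have gt: "n \<le> hamming_dist X (g a x) t" "n \<le> hamming_dist X t (g a x)"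
    if a: "a \<in> A" "x \<in> V" "t \<in> T" for a x t
  proof -
    have "y = z" if yz: "y \<in> X" "z \<in> X" "g a x y = t y" "g a x z = t z" for y z
    proof -
      \<comment> \<open>The word \<open>t\<close> fixes \<open>w\<close> and preserves
        \<open>V\<close>, while \<open>g a x\<close> sends \<open>w\<close> into \<open>V\<close>
        and \<open>u a x\<close> to \<open>w\<close>: neither rerouted point is an
        agreement.\<close>
      have *: "v \<in> V \<and> f a x v = t v" if "v \<in> X" "g a x v = t v" for v
        using that a u(1) t_w t_V g_u g_w g_V f_V V(3) unfolding X_def
        by (metis insertE)
      show ?thesis
        using *[of y] *[of z] yz f(5)[of a t x y z] a by metis
    qed
    then show "n \<le> hamming_dist X (g a x) t" "n \<le> hamming_dist X t (g a x)"
      by (metis hamming_dist_geI[OF X])+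
  qed
  have tt: "n \<le> hamming_dist X t t'" if "t \<in> T" "t' \<in> T" "t \<noteq> t'" for t t'
    using that T(4) by (intro hamming_dist_geI[OF X]) (auto simp: X_def)
  let ?C = "T \<union> (\<lambda>(a, x). g a x) ` (A \<times> V)"
  have "card {\<sigma> \<in> ?C. \<sigma> x = x} = r" if "x \<in> X" for x
  proof (cases "x = w")
    case True
    have "{\<sigma> \<in> ?C. \<sigma> x = x} = T"
      using True g_fix V(3) t_w by (auto simp: X_def)
    then show ?thesis using T(1) by simp
  next
    case False
    then have x: "x \<in> V" using that by (simp add: X_def)
    have "{\<sigma> \<in> ?C. \<sigma> x = x} = (\<lambda>a. g a x) ` A"
      using False t_fix that x g_fix by (auto simp: image_iff)
    moreover have "inj_on (\<lambda>a. g a x) A"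
    proof (rule inj_onI)
      fix a a' assume a: "a \<in> A" "a' \<in> A" "g a x = g a' x"
      \<comment> \<open>The preimage of \<open>w\<close> under a word determines its index
        \<open>a\<close>.\<close>
      then have "u a x = u a' x"
        using g_u[OF _ x] permutes_inj[OF g_perm[OF _ x]] by (metis injD)
      then show "a = a'" using u(3) a x by blast
    qed
    ultimately show ?thesis by (simp add: card_image A)
  qed
  moreover have "permutation_code (Suc n) n X ?C"
    unfolding permutation_code_def using X g_perm t_perm gg gt tt by auto
  moreover have "idempotent_code X ?C"
    unfolding idempotent_code_def
  proof
    fix \<sigma> assume "\<sigma> \<in> ?C"
    then obtain z where "z \<in> X" "\<And>y. y \<in> X \<Longrightarrow> \<sigma> y = y \<longleftrightarrow> y = z"
      using t_fix g_fix unfolding X_def by fastforce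
    then show "\<exists>!x. x \<in> X \<and> \<sigma> x = x" by blast
  qed
  ultimately show ?thesis
    unfolding r_IPC_def X_def[symmetric] g_def by blast
qed

section \<open>Affine maps over a quadratic extension of finite fields\<close>

text \<open>The cardinality assumption stands in for dimension two over \<open>K\<close>: it
  supplies \<theta> outside \<open>K\<close>, and it turns linear independence of 1 and
  \<open>a\<close> into a direct sum decomposition by counting.\<close>

lemma (in field) r_IPC_of_quadratic_subfield:
  assumes fin: "finite (carrier R)" and K: "subfield K R"
    and card_R: "card (carrier R) = (card K)\<^sup>2" and w: "w \<notin> carrier R"
  shows "\<exists>C. r_IPC (card K - 1) (Suc ((card K)\<^sup>2)) ((card K)\<^sup>2) (insert w (carrier R)) C"
proof -
  have sub: "K \<subseteq> carrier R" by (rule subfieldE(3)[OF K])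
  note subr = subringE[OF subfieldE(1)[OF K]]
  have finK: "finite K" using sub fin by (rule finite_subset)
  have Kdiff: "k \<ominus> l \<in> K" if "k \<in> K" "l \<in> K" for k l
    using that subr by (simp add: a_minus_def)
  \<comment> \<open>Linear independence of 1 and \<open>b\<close> over \<open>K\<close> for
    \<open>b\<close> outside \<open>K\<close>.\<close>
  have K_cancel: "k = \<zero>" if "k \<in> K" "b \<in> carrier R" "b \<otimes> k \<in> K" "b \<notin> K" for k b
  proof (rule ccontr)
    assume "k \<noteq> \<zero>"
    then have "inv k \<in> K" "k \<otimes> inv k = \<one>" "inv k \<in> carrier R"
      using subfield_m_inv[OF K, of k] that(1) sub by auto
    then have "(b \<otimes> k) \<otimes> inv k = b"
      using that sub by (simp add: m_assoc subsetD)
    moreover have "(b \<otimes> k) \<otimes> inv k \<in> K"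
      using subr(6) that(3) \<open>inv k \<in> K\<close> by blast
    ultimately show False using that(4) by simp
  qed
  have "card {\<zero>, \<one>} \<le> card K"
    using finK subr(2,3) by (intro card_mono) auto
  then have "1 < card K"
    using one_not_zero by simp
  then have "card K < card (carrier R)"
    using card_R by (simp add: power2_eq_square)
  then obtain \<theta> where \<theta>: "\<theta> \<in> carrier R" "\<theta> \<notin> K"
    using finK card_mono by (metis leD subsetI)
  define A where "A = (\<lambda>c. c \<otimes> \<theta>) ` (K - {\<zero>})"
  have A_diff: "a = a'" if "a \<in> A" "a' \<in> A" "a \<ominus> a' \<in> K" for a a'
  proof -
    obtain c c' where c: "c \<in> K" "c' \<in> K" "a = c \<otimes> \<theta>" "a' = c' \<otimes> \<theta>"
      using \<open>a \<in> A\<close> \<open>a' \<in> A\<close> by (auto simp: A_def)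
    then have car: "c \<in> carrier R" "c' \<in> carrier R" using sub by auto
    have "a \<ominus> a' = \<theta> \<otimes> (c \<ominus> c')"
      unfolding c using car \<theta>(1) by algebra
    then have "c \<ominus> c' = \<zero>"
      using K_cancel[OF Kdiff[OF c(1,2)] \<theta>(1) _ \<theta>(2)] that(3) by simp
    then show ?thesis using car c by simp
  qed
  have A_car: "a \<in> carrier R" and A_K: "a \<notin> K" if a: "a \<in> A" for a
  proof -
    obtain c where c: "c \<in> K" "c \<noteq> \<zero>" "a = c \<otimes> \<theta>" using a by (auto simp: A_def)
    then show "a \<in> carrier R" using sub \<theta> by auto
    show "a \<notin> K" using K_cancel[OF c(1) \<theta>(1) _ \<theta>(2)] c sub \<theta>(1) m_comm by auto
  qed
  have card_A: "card A = card K - 1"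
  proof -
    have "inj_on (\<lambda>c. c \<otimes> \<theta>) (K - {\<zero>})"
      using sub \<theta> subr(2) by (intro inj_onI) (metis DiffD1 m_rcancel subsetD)
    then show ?thesis using subr(2) by (simp add: A_def card_image)
  qed
  \<comment> \<open>Both families are the identity off the carrier, as \<open>permutes\<close>
    requires.\<close>
  define f where "f a x y = (if y \<in> carrier R then a \<otimes> (y \<ominus> x) \<oplus> x else y)" for a x y
  define t where "t c y = (if y \<in> carrier R then y \<oplus> c else y)" for c y
  have zero_mult: "c = d" if "b \<in> carrier R" "b \<noteq> \<zero>" "c \<in> carrier R" "d \<in> carrier R"
    "b \<otimes> (c \<ominus> d) = \<zero>" for b c d
    using that integral[of b "c \<ominus> d"] by auto
  have permutesI: "h permutes carrier R" if "\<And>y. y \<in> carrier R \<Longrightarrow> h y \<in> carrier R"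
    "inj_on h (carrier R)" "\<And>y. y \<notin> carrier R \<Longrightarrow> h y = y" for h
  proof (rule bij_imp_permutes)
    have "h ` carrier R = carrier R"
      using that(1,2) by (intro endo_inj_surj[OF fin]) auto
    then show "bij_betw h (carrier R) (carrier R)"
      using that(2) by (simp add: bij_betw_def)
  qed (rule that(3))
  \<comment> \<open>Both 0 and 1 lie in \<open>K\<close>, which \<open>A\<close> avoids. The first
    inequality makes \<open>f a x\<close> injective, the second makes its fixed point
    unique.\<close>
  have A_nz: "a \<noteq> \<zero>" "\<one> \<ominus> a \<noteq> \<zero>" if "a \<in> A" for a
    using A_K[OF that] A_car[OF that] subr(2,3) by auto
  have f_diff: "f a x y \<ominus> f a x z = a \<otimes> (y \<ominus> z)"
    if "a \<in> A" "x \<in> carrier R" "y \<in> carrier R" "z \<in> carrier R" for a x y z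
  proof -
    note a = A_car[OF that(1)]
    have "(b \<oplus> x) \<ominus> (c \<oplus> x) = b \<ominus> c" if "b \<in> carrier R" "c \<in> carrier R" for b c
      using that \<open>x \<in> carrier R\<close> by algebra
    moreover have "a \<otimes> (y \<ominus> x) \<ominus> a \<otimes> (z \<ominus> x) = a \<otimes> (y \<ominus> z)"
      using that a by algebra
    ultimately show ?thesis using that a by (simp add: f_def)
  qed
  have f_car: "f a x y \<in> carrier R" if "a \<in> A" "x \<in> carrier R" "y \<in> carrier R" for a x y
    using that A_car[OF that(1)] by (simp add: f_def)
  have f_perm: "f a x permutes carrier R" if "a \<in> A" "x \<in> carrier R" for a x
  proof (rule permutesI)
    note [simp] = A_car[OF that(1)] that
    show "f a x y \<in> carrier R" if "y \<in> carrier R" for y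
      using that by (simp add: f_def)
    show "inj_on (f a x) (carrier R)"
    proof (rule inj_onI)
      fix y z assume yz: "y \<in> carrier R" "z \<in> carrier R" "f a x y = f a x z"
      then have "a \<otimes> (y \<ominus> z) = \<zero>"
        using f_diff[OF that yz(1,2)] f_car[OF that yz(2)] by (metis r_right_minus_eq)
      then show "y = z" using zero_mult[of a y z] A_nz(1)[OF that(1)] yz by simp
    qed
  qed (simp add: f_def)
  have t_perm: "t c permutes carrier R" if "c \<in> carrier R" for c
    by (rule permutesI) (use that in \<open>auto simp: t_def inj_on_def\<close>)
  \<comment> \<open>With \<open>v = a + k\<close>, the condition on \<open>f a x v\<close> becomes
    \<open>l - a k = a a - a x + x - a + \<theta>\<close>. The map \<open>?h\<close> is injective on
    \<open>K \<times> K\<close> by independence of 1 and \<open>a\<close>, hence onto because both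
    sides have the same finite size.\<close>
  have ex_u: "\<exists>v. \<exists>k\<in>K. \<exists>l\<in>K. v = a \<oplus> k \<and> f a x v = a \<ominus> \<theta> \<oplus> l"
    if "a \<in> A" "x \<in> carrier R" for a x
  proof -
    note a = A_car[OF that(1)]
    let ?h = "\<lambda>(k, l). l \<ominus> a \<otimes> k"
    have "inj_on ?h (K \<times> K)"
    proof (rule inj_onI, clarify)
      fix k l k' l' assume kl: "k \<in> K" "l \<in> K" "k' \<in> K" "l' \<in> K" "l \<ominus> a \<otimes> k = l' \<ominus> a \<otimes> k'"
      then have car: "k \<in> carrier R" "l \<in> carrier R" "k' \<in> carrier R" "l' \<in> carrier R"
        using sub by auto
      define c where "c = l' \<ominus> a \<otimes> k'"
      have c: "c \<in> carrier R" using car a by (simp add: c_def)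
      \<comment> \<open>The two bracketed terms are equal values of \<open>?h\<close>, so they
        cancel and \<open>a (k - k')\<close> lies in \<open>K\<close>.\<close>
      have "a \<otimes> (k \<ominus> k') = l \<ominus> l' \<oplus> (l' \<ominus> a \<otimes> k') \<ominus> (l \<ominus> a \<otimes> k)"
        using car a by algebra
      also have "\<dots> = l \<ominus> l' \<oplus> c \<ominus> c"
        by (simp add: kl(5) c_def)
      also have "\<dots> = l \<ominus> l'" using car c by algebra
      finally have "k \<ominus> k' = \<zero>"
        using K_cancel[OF Kdiff[OF kl(1,3)] a _ A_K[OF that(1)]] Kdiff[OF kl(2,4)] by simp
      then have "k = k'" using car by simp
      then have "l = l'" using kl(5) car a by (simp add: a_minus_def)
      with \<open>k = k'\<close> show "k = k' \<and> l = l'" by simp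
    qed
    then have "card (?h ` (K \<times> K)) = card (carrier R)"
      by (simp add: card_image card_cartesian_product card_R power2_eq_square)
    moreover have "?h ` (K \<times> K) \<subseteq> carrier R"
      using sub a by auto
    ultimately have "?h ` (K \<times> K) = carrier R"
      using fin by (intro card_subset_eq)
    moreover have "a \<otimes> a \<ominus> a \<otimes> x \<oplus> x \<ominus> a \<oplus> \<theta> \<in> carrier R"
      using a that \<theta> by simp
    ultimately have "a \<otimes> a \<ominus> a \<otimes> x \<oplus> x \<ominus> a \<oplus> \<theta> \<in> ?h ` (K \<times> K)"
      by simp
    then obtain k l where kl: "k \<in> K" "l \<in> K"
      "l \<ominus> a \<otimes> k = a \<otimes> a \<ominus> a \<otimes> x \<oplus> x \<ominus> a \<oplus> \<theta>"
      by (elim imageE SigmaE) simp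
    then have car: "k \<in> carrier R" "l \<in> carrier R" using sub by auto
    have "a \<otimes> ((a \<oplus> k) \<ominus> x) \<oplus> x
        = (a \<otimes> a \<ominus> a \<otimes> x \<oplus> x \<ominus> a \<oplus> \<theta>) \<oplus> (a \<otimes> k) \<oplus> (a \<ominus> \<theta>)"
      using car a that \<theta> by algebra
    also have "\<dots> = a \<ominus> \<theta> \<oplus> l"
      unfolding kl(3)[symmetric] using car a that \<theta> by algebra
    finally have "f a x (a \<oplus> k) = a \<ominus> \<theta> \<oplus> l"
      using car a by (simp add: f_def)
    then show ?thesis using kl by blast
  qed
  then obtain u where u: "\<And>a x. \<lbrakk>a \<in> A; x \<in> carrier R\<rbrakk> \<Longrightarrow> \<exists>k\<in>K. u a x = a \<oplus> k"
    "\<And>a x. \<lbrakk>a \<in> A; x \<in> carrier R\<rbrakk> \<Longrightarrow> \<exists>l\<in>K. f a x (u a x) = a \<ominus> \<theta> \<oplus> l"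
    by metis
  have "r_IPC (card K - 1) (Suc ((card K)\<^sup>2)) ((card K)\<^sup>2) (insert w (carrier R))
     (t ` (K - {\<zero>}) \<union> (\<lambda>(a, x). extend_perm w (u a x) (f a x)) ` (A \<times> carrier R))"
  proof (rule r_IPC_by_extension[OF fin card_R w card_A])
    have "inj_on t K"
    proof (rule inj_onI)
      fix c d assume "c \<in> K" "d \<in> K" "t c = t d"
      then have "t c \<zero> = t d \<zero>" "c \<in> carrier R" "d \<in> carrier R" using sub by auto
      then show "c = d" by (simp add: t_def)
    qed
    then show "card (t ` (K - {\<zero>})) = card K - 1"
      using subr(2) by (simp add: card_image inj_on_diff)
    show "s permutes carrier R" if "s \<in> t ` (K - {\<zero>})" for s
      using that sub t_perm by auto
    show "s y \<noteq> y" if "s \<in> t ` (K - {\<zero>})" "y \<in> carrier R" for s y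
      using that sub by (auto simp: t_def)
    show "s = s'" if st: "s \<in> t ` (K - {\<zero>})" "s' \<in> t ` (K - {\<zero>})" "y \<in> carrier R" "s y = s' y" for s s' y
    proof -
      obtain c d where "s = t c" "s' = t d" "c \<in> carrier R" "d \<in> carrier R"
        using st(1,2) sub by auto
      then show ?thesis using st(3,4) by (simp add: t_def)
    qed
    show "f a x permutes carrier R" if "a \<in> A" "x \<in> carrier R" for a x
      using f_perm that .
    \<comment> \<open>As a function of the centre \<open>x\<close>, the value \<open>f a x y\<close>
      is affine with slope \<open>1 - a\<close>, which is nonzero.\<close>
    show same: "x = x'" if "a \<in> A" "x \<in> carrier R" "x' \<in> carrier R" "y \<in> carrier R"
      "f a x y = f a x' y" for a x x' y
    proof -
      note a = A_car[OF that(1)]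
      have "(\<one> \<ominus> a) \<otimes> (x \<ominus> x') = (a \<otimes> (y \<ominus> x) \<oplus> x) \<ominus> (a \<otimes> (y \<ominus> x') \<oplus> x')"
        using that(2-4) a by algebra
      also have "\<dots> = f a x y \<ominus> f a x' y" using that by (simp add: f_def)
      also have "\<dots> = \<zero>" using that f_car by (metis r_right_minus_eq)
      finally show ?thesis using zero_mult[of "\<one> \<ominus> a" x x'] A_nz(2)[OF that(1)] that a by simp
    qed
    show "f a x y = y \<longleftrightarrow> y = x" if "a \<in> A" "x \<in> carrier R" "y \<in> carrier R" for a x y
    proof -
      have "f a z z = z" if "z \<in> carrier R" for z
        using that A_car[OF \<open>a \<in> A\<close>] by (simp add: f_def a_minus_def r_neg)
      then show ?thesis using same[OF that(1,2), of y y] that by metis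
    qed
    show "y = z" if "a \<in> A" "a' \<in> A" "a \<noteq> a'" "x \<in> carrier R" "x' \<in> carrier R" "y \<in> carrier R"
      "z \<in> carrier R" "f a x y = f a' x' y" "f a x z = f a' x' z" for a a' x x' y z
    proof -
      note a = A_car[OF that(1)] A_car[OF that(2)]
      have "(a \<ominus> a') \<otimes> (y \<ominus> z) = a \<otimes> (y \<ominus> z) \<ominus> a' \<otimes> (y \<ominus> z)"
        using that(6,7) a by algebra
      also have "\<dots> = \<zero>"
        using f_diff[of a x y z] f_diff[of a' x' y z] that a
        by (metis minus_closed m_closed r_right_minus_eq)
      finally show ?thesis using zero_mult[of "a \<ominus> a'" y z] that a by auto
    qed
    show "y = z" if "a \<in> A" "s \<in> t ` (K - {\<zero>})" "x \<in> carrier R" "y \<in> carrier R" "z \<in> carrier R"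
      "f a x y = s y" "f a x z = s z" for a s x y z
    proof -
      note a = A_car[OF that(1)]
      obtain c where c: "s = t c" "c \<in> carrier R"
        using \<open>s \<in> t ` (K - {\<zero>})\<close> sub by auto
      \<comment> \<open>A translation is an affine map of slope 1, and this slope does not occur in
        \<open>A\<close>.\<close>
      have "(\<one> \<ominus> a) \<otimes> (y \<ominus> z) = (t c y \<ominus> t c z) \<ominus> a \<otimes> (y \<ominus> z)"
        unfolding t_def using that(4,5) a c(2) by (simp, algebra)
      also have "\<dots> = \<zero>"
        using f_diff[of a x y z] that a c by (metis minus_closed m_closed r_right_minus_eq)
      finally show ?thesis using zero_mult[of "\<one> \<ominus> a" y z] A_nz(2)[OF that(1)] that a by simp
    qed
    show "u a x \<in> carrier R" if "a \<in> A" "x \<in> carrier R" for a x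
      using u(1)[OF that] A_car[OF that(1)] sub by auto
    have cosets: "b \<ominus> b' \<in> K" if "b \<oplus> k = b' \<oplus> l" "k \<in> K" "l \<in> K" "b \<in> carrier R" "b' \<in> carrier R"
      for b b' k l
    proof -
      have car: "k \<in> carrier R" "l \<in> carrier R" using that sub by auto
      have "b \<ominus> b' = ((b \<oplus> k) \<ominus> (b' \<oplus> l)) \<oplus> (l \<ominus> k)"
        using that(4,5) car by algebra
      also have "(b \<oplus> k) \<ominus> (b' \<oplus> l) = \<zero>"
        using that(1,5) car by (metis a_closed r_right_minus_eq)
      also have "\<zero> \<oplus> (l \<ominus> k) = l \<ominus> k" using car by simp
      finally show ?thesis using Kdiff that by simp
    qed
    \<comment> \<open>If \<open>u a x\<close> were the fixed point \<open>x\<close>, then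
      \<open>x\<close> would lie in both \<open>a + K\<close> and \<open>a - \<theta> + K\<close>,
      forcing \<theta> into \<open>K\<close>. This is why the target coset is shifted by
      \<theta>.\<close>
    show "u a x \<noteq> x" if ax: "a \<in> A" "x \<in> carrier R" for a x
    proof
      assume eq: "u a x = x"
      note a = A_car[OF ax(1)]
      obtain k l where kl: "k \<in> K" "l \<in> K" "x = a \<oplus> k" "f a x x = a \<ominus> \<theta> \<oplus> l"
        using u[OF ax] eq by metis
      have "f a x x = x" using ax a by (simp add: f_def a_minus_def r_neg)
      then have "a \<oplus> k = a \<ominus> \<theta> \<oplus> l" using kl by simp
      then have "a \<ominus> (a \<ominus> \<theta>) \<in> K" using cosets kl a \<theta> by simp
      moreover have "a \<ominus> (a \<ominus> \<theta>) = \<theta>" using a \<theta>(1) by algebra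
      ultimately show False using \<theta> by simp
    qed
    show "a = a'" if "a \<in> A" "a' \<in> A" "x \<in> carrier R" "x' \<in> carrier R" "u a x = u a' x'" for a a' x x'
      using u(1)[OF that(1,3)] u(1)[OF that(2,4)] cosets A_car that A_diff by metis
    show "a = a'" if "a \<in> A" "a' \<in> A" "x \<in> carrier R" "x' \<in> carrier R"
      "f a x (u a x) = f a' x' (u a' x')" for a a' x x'
    proof -
      note ax = that and a = A_car[OF that(1)] A_car[OF that(2)]
      obtain k l where "k \<in> K" "l \<in> K" "a \<ominus> \<theta> \<oplus> k = a' \<ominus> \<theta> \<oplus> l"
        using u(2)[OF ax(1,3)] u(2)[OF ax(2,4)] ax(5) by metis
      then have "(a \<ominus> \<theta>) \<ominus> (a' \<ominus> \<theta>) \<in> K" using cosets a \<theta> by simp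
      moreover have "(a \<ominus> \<theta>) \<ominus> (a' \<ominus> \<theta>) = a \<ominus> a'" using a \<theta>(1) by algebra
      ultimately show ?thesis using A_diff that by simp
    qed
  qed
  then show ?thesis ..
qed

section \<open>Binomial theorem and freshman's dream\<close>

lemma (in cring) binomial_cring:
  assumes "x \<in> carrier R" "y \<in> carrier R"
  shows "(x \<oplus> y) [^] (n::nat) = (\<Oplus>k\<in>{..n}. [(n choose k)] \<cdot> (x [^] k \<otimes> y [^] (n - k)))"
proof (induction n)
  case 0
  show ?case using assms by simp
next
  case (Suc n)
  define m where "m k = x [^] k \<otimes> y [^] (Suc n - k)" for k
  have m[simp]: "m k \<in> carrier R" for k using assms by (simp add: m_def)
  let ?s = "\<Oplus>k\<in>{..n}. [(n choose k)] \<cdot> (x [^] k \<otimes> y [^] (n - k))"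
  have "?s \<otimes> x = (\<Oplus>k\<in>{..n}. [(n choose k)] \<cdot> m (Suc k))"
    using assms by (subst finsum_ldistr) (auto simp: m_def add_pow_rdistr add_pow_ldistr m_ac intro!: finsum_cong')
  moreover have "?s \<otimes> y = (\<Oplus>k\<in>{..n}. [(n choose k)] \<cdot> m k)"
  proof -
    have "[(n choose k)] \<cdot> (x [^] k \<otimes> y [^] (n - k)) \<otimes> y = [(n choose k)] \<cdot> m k" if "k \<le> n" for k
      using assms that by (simp add: m_def add_pow_ldistr m_assoc Suc_diff_le)
    then show ?thesis
      using assms by (subst finsum_ldistr) (auto intro!: finsum_cong')
  qed
  moreover have "(\<Oplus>k\<in>{..n}. [(n choose k)] \<cdot> m k)
      = (\<Oplus>k\<in>{..n}. [(n choose Suc k)] \<cdot> m (Suc k)) \<oplus> m 0"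
  proof -
    \<comment> \<open>The added top term has coefficient \<open>n choose Suc n\<close>, which is 0;
      the range can then be split at its bottom end for Pascal's rule.\<close>
    have "(\<Oplus>k\<in>{..Suc n}. [(n choose k)] \<cdot> m k) = (\<Oplus>k\<in>{..n}. [(n choose k)] \<cdot> m k)"
      by (subst finsum_Suc) (auto simp: binomial_eq_0 Pi_def)
    moreover have "(\<Oplus>k\<in>{..Suc n}. [(n choose k)] \<cdot> m k)
        = (\<Oplus>k\<in>{..n}. [(n choose Suc k)] \<cdot> m (Suc k)) \<oplus> m 0"
      by (subst finsum_Suc2) (auto simp: Pi_def)
    ultimately show ?thesis by simp
  qed
  ultimately have "(x \<oplus> y) [^] Suc n = (\<Oplus>k\<in>{..n}. [(n choose k)] \<cdot> m (Suc k))
      \<oplus> ((\<Oplus>k\<in>{..n}. [(n choose Suc k)] \<cdot> m (Suc k)) \<oplus> m 0)"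
    using assms by (simp add: Suc.IH r_distr)
  also have "\<dots> = (\<Oplus>k\<in>{..n}. [(Suc n choose Suc k)] \<cdot> m (Suc k)) \<oplus> m 0"
    by (simp add: add.nat_pow_mult[symmetric] finsum_addf Pi_def a_assoc)
  also have "\<dots> = (\<Oplus>k\<in>{..Suc n}. [(Suc n choose k)] \<cdot> m k)"
    by (subst finsum_Suc2) (auto simp: Pi_def)
  finally show ?case by (simp add: m_def)
qed

lemma (in cring) add_pow_dvd_eq_zero:
  assumes "[p] \<cdot> \<one> = \<zero>" "p dvd n" "x \<in> carrier R"
  shows "[(n::nat)] \<cdot> x = \<zero>"
proof -
  obtain m where n: "n = p * m" using assms(2) by (rule dvdE)
  have "[p] \<cdot> x = ([p] \<cdot> \<one>) \<otimes> x"
    using assms(3) by (simp add: add_pow_ldistr)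
  then have "[p] \<cdot> x = \<zero>" using assms(1,3) by simp
  then show ?thesis using assms(3) add.nat_pow_pow[of x m p] by (simp add: n mult.commute)
qed

text \<open>The inner binomial coefficients are divisible by \<open>p\<close>. The characteristic
  enters through \<open>[p] \<cdot> \<one> = \<zero>\<close>, a condition that passes along ring
  homomorphisms.\<close>

lemma (in cring) freshmans_dream_cring:
  assumes "Factorial_Ring.prime (p::nat)" "[p] \<cdot> \<one> = \<zero>" "x \<in> carrier R" "y \<in> carrier R"
  shows "(x \<oplus> y) [^] p = x [^] p \<oplus> y [^] p"
proof -
  let ?t = "\<lambda>k. [(p choose k)] \<cdot> (x [^] k \<otimes> y [^] (p - k))"
  have "p > 0" using assms(1) prime_gt_0_nat by blast
  have "(\<Oplus>k\<in>{..p}. ?t k) = (\<Oplus>k\<in>{0, p}. ?t k)"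
  proof (rule add.finprod_mono_neutral_cong_right)
    show "?t k = \<zero>" if "k \<in> {..p} - {0, p}" for k
      using that assms by (intro add_pow_dvd_eq_zero[OF assms(2)] dvd_choose_prime) auto
  qed (use assms in auto)
  also have "\<dots> = x [^] p \<oplus> y [^] p"
    using \<open>p > 0\<close> assms(3,4) by (simp add: a_comm)
  finally show ?thesis using binomial_cring[OF assms(3,4), of p] by simp
qed

lemma (in cring) freshmans_dream_cring':
  assumes "Factorial_Ring.prime (p::nat)" "[p] \<cdot> \<one> = \<zero>" "x \<in> carrier R" "y \<in> carrier R"
  shows "(x \<oplus> y) [^] (p ^ n) = x [^] (p ^ n) \<oplus> y [^] (p ^ n)"
proof (induction n)
  case (Suc n)
  have "z [^] (p ^ Suc n) = (z [^] (p ^ n)) [^] p" if "z \<in> carrier R" for z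
    using that by (simp add: nat_pow_pow mult.commute)
  then show ?case
    using Suc assms freshmans_dream_cring[OF assms(1,2)] by simp
qed (use assms in simp)

text \<open>Carries the condition \<open>[p] \<cdot> \<one> = \<zero>\<close> to the polynomial ring
  and from the prime field to its closure.\<close>

lemma (in ring_hom_ring) hom_add_pow:
  "x \<in> carrier R \<Longrightarrow> h ([(n::nat)] \<cdot>\<^bsub>R\<^esub> x) = [n] \<cdot>\<^bsub>S\<^esub> h x"
  by (induction n) (simp_all add: R.add.nat_pow_Suc S.add.nat_pow_Suc)

section \<open>Fixed fields of powers of Frobenius\<close>

context field
begin

text \<open>The roots of \<open>X^q - X\<close> in the field; for \<open>q\<close> a positive power
  of the characteristic, the fixed field of a power of Frobenius.\<close>

definition frobenius_fixed :: "nat \<Rightarrow> 'a set" where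
  "frobenius_fixed q = {x \<in> carrier R. x [^] q = x}"

context
  fixes p n q :: nat
  assumes p: "Factorial_Ring.prime p" "[p] \<cdot> \<one> = \<zero>" and q: "q = p ^ n" "n > 0"
begin

lemma q_gt_1: "q > 1"
  using p(1) q prime_gt_1_nat one_less_power by blast

text \<open>Additivity of the \<open>q\<close>-th power on \<open>x + (-x) = 0\<close> treats odd
  \<open>q\<close> and characteristic two alike.\<close>

lemma uminus_mem_frobenius_fixed:
  assumes "x \<in> frobenius_fixed q"
  shows "\<ominus> x \<in> frobenius_fixed q"
proof -
  have x: "x \<in> carrier R" "x [^] q = x" using assms by (auto simp: frobenius_fixed_def)
  have "\<zero> = (x \<oplus> \<ominus> x) [^] q"
    using x q_gt_1 by (simp add: r_neg nat_pow_zero)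
  also have "\<dots> = x \<oplus> (\<ominus> x) [^] q"
    using x freshmans_dream_cring'[OF p, of x "\<ominus> x" n] by (simp add: q(1))
  finally have "(\<ominus> x) [^] q = \<ominus> x"
    using x by (metis a_comm a_inv_closed minus_equality nat_pow_closed)
  then show ?thesis using x by (simp add: frobenius_fixed_def)
qed

lemma subfield_frobenius_fixed: "subfield (frobenius_fixed q) R"
proof (rule subfieldI')
  show "subring (frobenius_fixed q) R"
  proof (rule subringI)
    show "\<ominus> h \<in> frobenius_fixed q" if "h \<in> frobenius_fixed q" for h
      using uminus_mem_frobenius_fixed that .
  qed (auto simp: frobenius_fixed_def nat_pow_distrib q(1) freshmans_dream_cring'[OF p])
  fix k assume k: "k \<in> frobenius_fixed q - {\<zero>}"
  then have k': "k \<in> carrier R" "k [^] q = k" "k \<in> Units R"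
    by (auto simp: frobenius_fixed_def field_Units)
  then have "k [^] q \<otimes> inv k [^] q = \<one>"
    by (metis Units_inv_closed Units_r_inv nat_pow_distrib nat_pow_one)
  then have "inv k [^] q = inv k"
    using k' by (metis Units_inv_closed comm_inv_char nat_pow_closed)
  then show "inv k \<in> frobenius_fixed q"
    using k' by (simp add: frobenius_fixed_def)
qed

text \<open>The polynomial \<open>X^q - X\<close> has degree \<open>q\<close>, splits, and has only
  simple roots, so it has \<open>q\<close> distinct ones.\<close>

lemma card_frobenius_fixed:
  assumes split: "\<And>P. P \<in> carrier (poly_ring R) \<Longrightarrow> splitted P"
  shows "finite (frobenius_fixed q)" "card (frobenius_fixed q) = q"
proof -
  interpret UP: domain "poly_ring R"
    using univ_poly_is_domain[OF carrier_is_subring] .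
  interpret const: ring_hom_ring R "poly_ring R" poly_of_const
    using canonical_embedding_ring_hom[OF carrier_is_subring] by simp
  let ?S = "poly_ring R" and ?X = "var R"
  define P where "P = ?X [^]\<^bsub>?S\<^esub> q \<ominus>\<^bsub>?S\<^esub> ?X"
  note X_closed = var_closed(1)[OF carrier_is_subring]
  have P: "P \<in> carrier ?S" using X_closed by (simp add: P_def)
  have deg: "degree P = q"
  proof -
    have "polynomial (carrier R) (monom \<one> q)" "polynomial (carrier R) (\<ominus>\<^bsub>?S\<^esub> ?X)"
      using X_closed unitary_monom_eq_var_pow[OF carrier_is_subring, of q]
      by (auto simp: univ_poly_carrier)
    moreover have "degree (monom \<one> q) = q" "degree (\<ominus>\<^bsub>?S\<^esub> ?X) = 1"
      using univ_poly_a_inv_degree[OF carrier_is_subring X_closed] by (simp_all add: monom_def var_def)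
    ultimately show ?thesis
      using q_gt_1 poly_add_degree_eq[OF carrier_is_subring]
      unfolding P_def a_minus_def unitary_monom_eq_var_pow[OF carrier_is_subring, symmetric] univ_poly_add
      by simp
  qed
  have root: "is_root P x \<longleftrightarrow> x \<in> frobenius_fixed q" for x
  proof (cases "x \<in> carrier R")
    case True
    interpret ev: ring_hom_ring ?S R "\<lambda>p. eval p x"
      using eval_ring_hom[OF carrier_is_subring True] .
    have "eval P x = x [^] q \<ominus> x"
      using X_closed True by (simp add: P_def a_minus_def ev.hom_nat_pow eval_var)
    moreover have "P \<noteq> []" using deg q_gt_1 by auto
    ultimately show ?thesis
      using True by (simp add: is_root_def frobenius_fixed_def)
  qed (auto simp: is_root_def frobenius_fixed_def)
  txt \<open>With \<open>M = X - a\<close> at a root \<open>a\<close>, the freshman's dream gives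
    \<open>P = M\<^sup>q - M = M (M\<^bsup>q-1\<^esup> - 1)\<close>, and the cofactor takes the value \<open>-1\<close> at \<open>a\<close>.\<close>
  have mult: "alg_mult P a \<le> 1" for a
  proof (rule ccontr)
    assume "\<not> alg_mult P a \<le> 1"
    then have two: "2 \<le> alg_mult P a" by simp
    then have a: "a \<in> frobenius_fixed q"
      using alg_mult_gt_zero_iff_is_root[OF P, of a] root by simp
    then have ac: "a \<in> carrier R" by (simp add: frobenius_fixed_def)
    define M where "M = [\<one>, \<ominus> a]"
    \<comment> \<open>Since \<open>a\<close> is fixed by the \<open>q\<close>-th power, so is the
      constant polynomial \<open>-a\<close>; therefore \<open>M^q - M\<close> equals
      \<open>X^q - X\<close>.\<close>
    define c where "c = poly_of_const (\<ominus> a)"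
    have "(\<ominus> a) [^] q = \<ominus> a"
      using uminus_mem_frobenius_fixed[OF a] by (simp add: frobenius_fixed_def)
    then have c: "c \<in> carrier ?S" "c [^]\<^bsub>?S\<^esub> q = c"
      using ac const.hom_nat_pow[of "\<ominus> a" q] by (simp_all only: c_def const.hom_closed a_inv_closed)
    have M_eq: "M = ?X \<oplus>\<^bsub>?S\<^esub> c"
      using ac by (simp add: M_def c_def univ_poly_add var_def poly_of_const_def)
    then have M: "M \<in> carrier ?S" using X_closed c by simp
    have p_UP: "[p] \<cdot>\<^bsub>?S\<^esub> \<one>\<^bsub>?S\<^esub> = \<zero>\<^bsub>?S\<^esub>"
      using const.hom_add_pow[of \<one> p] p(2) by simp
    have "M [^]\<^bsub>?S\<^esub> q = ?X [^]\<^bsub>?S\<^esub> q \<oplus>\<^bsub>?S\<^esub> c"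
      unfolding M_eq using UP.freshmans_dream_cring'[OF p(1) p_UP X_closed c(1), of n] c(2) by (simp add: q(1))
    then have "P = M [^]\<^bsub>?S\<^esub> q \<ominus>\<^bsub>?S\<^esub> M"
      unfolding P_def M_eq using X_closed c UP.nat_pow_closed[OF X_closed, of q] by (simp, algebra)
    moreover have "M [^]\<^bsub>?S\<^esub> q = M \<otimes>\<^bsub>?S\<^esub> M [^]\<^bsub>?S\<^esub> (q - 1)"
      using UP.nat_pow_Suc2[OF M, of "q - 1"] q_gt_1 by simp
    ultimately have P_fact: "P = M \<otimes>\<^bsub>?S\<^esub> (M [^]\<^bsub>?S\<^esub> (q - 1) \<ominus>\<^bsub>?S\<^esub> \<one>\<^bsub>?S\<^esub>)"
      using M by (simp add: a_minus_def UP.r_distr UP.r_minus)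
    obtain S where S: "S \<in> carrier ?S" "P = M \<otimes>\<^bsub>?S\<^esub> M \<otimes>\<^bsub>?S\<^esub> S"
      using le_alg_mult_imp_pdivides[OF ac P two] M
      by (auto simp: pdivides_def factor_def M_def[symmetric] numeral_2_eq_2)
    have "M \<noteq> \<zero>\<^bsub>?S\<^esub>" by (simp add: M_def univ_poly_zero)
    then have eq: "M [^]\<^bsub>?S\<^esub> (q - 1) \<ominus>\<^bsub>?S\<^esub> \<one>\<^bsub>?S\<^esub> = M \<otimes>\<^bsub>?S\<^esub> S"
      using P_fact S M by (simp add: UP.m_assoc UP.m_lcancel)
    interpret ev: ring_hom_ring ?S R "\<lambda>p. eval p a"
      using eval_ring_hom[OF carrier_is_subring ac] .
    have Ma: "eval M a = \<zero>" using ac by (simp add: M_def r_neg)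
    have "eval (M [^]\<^bsub>?S\<^esub> (q - 1) \<ominus>\<^bsub>?S\<^esub> \<one>\<^bsub>?S\<^esub>) a = \<zero>"
      unfolding eq using M S Ma by simp
    then have "\<ominus> \<one> = \<zero>"
      using M Ma q_gt_1 by (simp add: a_minus_def ev.hom_nat_pow nat_pow_zero)
    moreover have "\<one> = \<ominus> (\<ominus> \<one>)" by simp
    ultimately have "\<one> = \<zero>" by (simp only: minus_zero)
    then show False by simp
  qed
  have roots: "set_mset (roots P) = frobenius_fixed q"
    using root roots_mem_iff_is_root[OF P] by auto
  show "finite (frobenius_fixed q)" by (simp flip: roots)
  have "count (roots P) a = 1" if "a \<in># roots P" for a
    using that mult[of a] unfolding alg_mult_eq_count_roots[OF P] by (simp add: Suc_leI le_antisym)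
  then have "size (roots P) = card (set_mset (roots P))"
    by (simp add: size_multiset_overloaded_eq)
  then show "card (frobenius_fixed q) = q"
    using split[OF P] deg by (simp add: splitted_def roots)
qed

end

end

section \<open>Existence of the two finite fields\<close>

text \<open>Both fields are cut out of one algebraic closure of the prime field, so that one
  contains the other. The larger is then copied into \<open>nat\<close>, an infinite type that
  leaves room for the point at infinity.\<close>

lemma exists_field_card_power:
  assumes "Factorial_Ring.prime p" "n > 0"
  shows "\<exists>(F :: nat ring) K. field F \<and> finite (carrier F) \<and> subfield K F \<and>
    card K = p ^ n \<and> card (carrier F) = (p ^ n)\<^sup>2"
proof -
  interpret residues_prime p "residue_ring (int p)"
    by unfold_locales (use assms in auto)
  define Z where "Z = residue_ring (int p)"
  interpret Z: field Z unfolding Z_def by (rule is_field)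
  obtain L :: "((int list \<times> nat) multiset \<Rightarrow> int) ring"
    where L: "algebraic_closure L (Z.indexed_const ` carrier Z)" "Z.indexed_const \<in> ring_hom Z L"
    using Z.exists_closure by blast
  interpret L: algebraic_closure L "Z.indexed_const ` carrier Z" by (rule L(1))
  interpret h: ring_hom_ring Z L Z.indexed_const
    using ring_hom_ringI2[OF Z.ring_axioms L.ring_axioms L(2)] .
  \<comment> \<open>Evaluating multiples of 1 modulo \<open>p\<close> shows that \<open>p\<close>
    annihilates 1.\<close>
  have "[k] \<cdot>\<^bsub>Z\<^esub> \<one>\<^bsub>Z\<^esub> = int k mod int p" for k :: nat
    by (induction k)
      (simp_all add: Z.add.nat_pow_Suc Z_def res_add_eq res_zero_eq res_one_eq mod_simps add.commute)
  then have "[p] \<cdot>\<^bsub>Z\<^esub> \<one>\<^bsub>Z\<^esub> = \<zero>\<^bsub>Z\<^esub>"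
    by (simp add: Z_def res_zero_eq)
  then have "[p] \<cdot>\<^bsub>L\<^esub> \<one>\<^bsub>L\<^esub> = \<zero>\<^bsub>L\<^esub>"
    using h.hom_add_pow[of "\<one>\<^bsub>Z\<^esub>" p] by simp
  note p = assms(1) this
  let ?q = "p ^ n"
  \<comment> \<open>The square of \<open>p^n\<close> is again a positive power of \<open>p\<close>,
    so the results on Frobenius apply to it as well.\<close>
  have n2: "?q\<^sup>2 = p ^ (2 * n)" "2 * n > 0" using assms(2) by (simp_all add: power_mult[symmetric] mult.commute)
  define K where "K = L.frobenius_fixed ?q"
  define F where "F = L.frobenius_fixed (?q\<^sup>2)"
  have K: "subfield K L" "card K = ?q"
    using L.subfield_frobenius_fixed[OF p refl assms(2)]
      L.card_frobenius_fixed[OF p refl assms(2)] L.roots_over_carrier by (auto simp: K_def)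
  have F: "subfield F L" "card F = ?q\<^sup>2" "finite F"
    using L.subfield_frobenius_fixed[OF p n2]
      L.card_frobenius_fixed[OF p n2] L.roots_over_carrier by (auto simp: F_def)
  have KF: "K \<subseteq> F"
  proof
    fix x assume "x \<in> K"
    then show "x \<in> F"
      using L.nat_pow_pow[of x ?q ?q] by (simp add: K_def F_def L.frobenius_fixed_def power2_eq_square)
  qed
  let ?F = "L\<lparr>carrier := F\<rparr>"
  interpret F: field ?F by (rule L.subfield_iff(2)[OF F(1)])
  have KF': "subfield K ?F"
    using F.subfield_iff(1)[of K] L.subfield_iff(2)[OF K(1)] KF by simp
  obtain g :: "_ \<Rightarrow> nat" where g: "inj_on g F"
    using finite_imp_inj_to_nat_seg[OF F(3)] by blast
  define G where "G = image_ring g ?F"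
  have G: "field G" using F.inj_imp_image_ring_is_field[of g] g by (simp add: G_def)
  interpret G: field G by (rule G)
  have "g \<in> ring_hom ?F G"
    using inj_imp_image_ring_iso[of g ?F] g by (simp add: G_def ring_iso_def)
  then interpret g: ring_hom_ring ?F G g
    using ring_hom_ringI2 F.ring_axioms G.ring_axioms by blast
  have "subfield (g ` K) G"
    using g.img_is_subfield(2)[OF KF' G.one_not_zero] .
  moreover have "carrier G = g ` F" by (simp add: G_def image_ring_carrier)
  moreover have "card (g ` K) = ?q" "card (g ` F) = ?q\<^sup>2"
    using K F g KF by (auto simp: card_image inj_on_subset)
  ultimately show ?thesis
    using G F(3) by (intro exI[of _ G] exI[of _ "g ` K"]) simp
qed

theorem theorem4p1:
  fixes q :: nat
  assumes "primepow q"
  shows "\<exists>(X :: nat set) C. r_IPC (q - 1) (q^2 + 1) (q^2) X C"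
proof -
  obtain p n where "Factorial_Ring.prime p" "n > 0" and q: "q = p ^ n"
    using assms by (auto simp: primepow_def)
  then obtain F :: "nat ring" and K where F: "field F" "finite (carrier F)" "subfield K F"
    "card K = q" "card (carrier F) = q\<^sup>2"
    using exists_field_card_power by blast
  \<comment> \<open>This \<open>w\<close> plays the role of \<infinity>.\<close>
  obtain w where "w \<notin> carrier F"
    using ex_new_if_finite[OF infinite_UNIV_nat F(2)] by blast
  then have "\<exists>C. r_IPC (q - 1) (Suc (q\<^sup>2)) (q\<^sup>2) (insert w (carrier F)) C"
    using field.r_IPC_of_quadratic_subfield[OF F(1,2,3)] F(4,5) by metis
  then show ?thesis
    by auto
qed

end
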